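(* Let $\mu\in\Gamma$, and let the reduced spaces be $X^N_h(\Omega)=Z^N_h(\Omega)=Q^N_h(\Omega)$, where $$Q^N_h(\Omega)=\mathrm{span}\{u_h(\mu^n),\lambda_h(\mu^n):1\le n\le N\},$$ together with $Y^N_h(\Omega)=\mathrm{span}\{f_h(\mu^n):1\le n\le N\}$ and $\mathcal{U}^N_h(\Omega)=X^N_h(\Omega)\times Y^N_h(\Omega)$. Then the bilinear form $\mathcal{B}(\cdot,\cdot;\mu)$ satisfies the inf-sup condition on $\mathcal{U}^N_h(\Omega)\times Z^N_h(\Omega)$. Moreover, the inf-sup value $$\beta^N(\mu):=\inf_{0\ne\tilde u_g\in Z^N_h(\Omega)}\ \sup_{0\ne\underline{u}_g\in\mathcal{U}^N_h(\Omega)}\frac{\mathcal{B}(\underline{u}_g,\tilde u_g;\mu)}{\|\underline{u}_g\|_{\mathcal{U}^N_h(\Omega)}\,\|\tilde u_g\|_{Z^N_h(\Omega)}}$$ satisfies $$\beta^N(\mu)\ge\tilde\alpha^{\mathcal{N}}(\mu),$$ where $\tilde\alpha^{\mathcal{N}}(\mu)$ is the coercivity constant of the bilinear form $a(\cdot,\cdot;\mu)$ on the finite element space $V^h(\Omega)$.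
   Context: $\Omega\subset\mathbb{R}^d$ ($d\ge1$) is a convex bounded polygonal domain with Lipschitz boundary and $\Gamma\subset\mathbb{R}^m$ is a parameter set. For each $\mu\in\Gamma$, $a(\cdot,\cdot;\mu)$ is a bilinear form on $H^1(\Omega)$, and there are constants $\tilde\alpha_0,\tilde\alpha_1>0$ such that for all $\mu\in\Gamma$ and $u,v\in H^1(\Omega)$: $a(v,v;\mu)\ge\tilde\alpha_0\|v\|^2_{H^1(\Omega)}$ and $a(u,v;\mu)\le\tilde\alpha_1\|u\|_{H^1(\Omega)}\|v\|_{H^1(\Omega)}$. Moreover $a$ is affine in the parameter: $a(u,v;\mu)=\sum_{q=1}^{Q_a}Q_a^q(\mu)\,a^q(u,v)$ with functions $Q_a^q:\Gamma\to\mathbb{R}$ and symmetric $\mu$-independent bilinear forms $a^q$ on $H^1(\Omega)$. $V^h(\Omega)\subset H^1(\Omega)$ is a finite element space (finite-dimensional, of dimension $\mathcal{N}$), $V^h_0(\Omega)\subset V^h(\Omega)$ is the subspace of functions vanishing on $\partial\Omega$, and $M_h(\Omega)\subset L^2(\Omega)$ is a finite-dimensional subspace. The coercivity constant is $\tilde\alpha^{\mathcal{N}}(\mu)=\inf_{0\ne v\in V^h(\Omega)}a(v,v;\mu)/\|v\|^2_{H^1(\Omega)}$. Given $\beta>0$ and a target $\hat u(\cdot,\mu)\in L^2(\Omega)$, for each $\mu\in\Gamma$ the triple $(u_h(\mu),f_h(\mu),\lambda_h(\mu))\in V^h_0(\Omega)\times M_h(\Omega)\times V^h_0(\Omega)$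 denotes the finite element solution of the optimality system $$a(u_h,\widetilde u_h;\mu)=(f_h,\widetilde u_h),\quad a(\lambda_h,\widetilde\lambda_h;\mu)=-(u_h-\hat u,\widetilde\lambda_h),\quad 2\beta(f_h,\widetilde f_h)=(\widetilde f_h,\lambda_h)$$ for all $\widetilde u_h,\widetilde\lambda_h\in V^h_0(\Omega)$ and $\widetilde f_h\in M_h(\Omega)$, where $(\cdot,\cdot)$ is the $L^2(\Omega)$ inner product. $\mu^1,\dots,\mu^N\in\Gamma$ ($N\ge1$) are selected parameter samples. For $\underline{u}=(u,h)\in H^1(\Omega)\times L^2(\Omega)$ and $q\in H^1(\Omega)$, $\mathcal{B}(\underline{u},q;\mu)=a(u,q;\mu)-(h,q)$. The spaces $X^N_h(\Omega)$ and $Z^N_h(\Omega)$ carry the $H^1(\Omega)$ norm, $Y^N_h(\Omega)$ carries the $L^2(\Omega)$ norm, and $\|(u,h)\|_{\mathcal{U}^N_h(\Omega)}=\|u\|_{X^N_h(\Omega)}+\|h\|_{Y^N_h(\Omega)}$. "Satisfies the inf-sup condition" means $\beta^N(\mu)>0$ (an infimum over an empty set being $+\infty$). *)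

theory Defs
  imports "HOL-Analysis.Analysis"
begin

definition ae_eq :: "('a::euclidean_space \<Rightarrow> real) \<Rightarrow> ('a \<Rightarrow> real) \<Rightarrow> bool" where
  "ae_eq f g \<longleftrightarrow> f \<in> borel_measurable lebesgue \<and> g \<in> borel_measurable lebesgue \<and>
     (AE x in lebesgue. f x = g x)"

lemma part_equivp_ae_eq: "part_equivp (ae_eq :: ('a::euclidean_space \<Rightarrow> real) \<Rightarrow> _)"
proof (rule part_equivpI)
  show "\<exists>f::'a \<Rightarrow> real. ae_eq f f"
    by (rule exI[of _ "\<lambda>_. 0"]) (simp add: ae_eq_def)
  show "symp (ae_eq :: ('a \<Rightarrow> real) \<Rightarrow> _)"
    by (auto simp: symp_def ae_eq_def eq_commute)
  show "transp (ae_eq :: ('a \<Rightarrow> real) \<Rightarrow> _)"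
    unfolding transp_def ae_eq_def by (auto elim: AE_mp)
qed

quotient_type (overloaded) 'a ae_fun = "'a::euclidean_space \<Rightarrow> real" / partial: ae_eq
  by (rule part_equivp_ae_eq)

instantiation ae_fun :: (euclidean_space) real_vector
begin

lift_definition zero_ae_fun :: "'a ae_fun" is "\<lambda>_. 0"
  by (simp add: ae_eq_def)

lift_definition plus_ae_fun :: "'a ae_fun \<Rightarrow> 'a ae_fun \<Rightarrow> 'a ae_fun" is "\<lambda>f g x. f x + g x"
  unfolding ae_eq_def by (auto elim: AE_mp)

lift_definition minus_ae_fun :: "'a ae_fun \<Rightarrow> 'a ae_fun \<Rightarrow> 'a ae_fun" is "\<lambda>f g x. f x - g x"
  unfolding ae_eq_def by (auto elim: AE_mp)

lift_definition uminus_ae_fun :: "'a ae_fun \<Rightarrow> 'a ae_fun" is "\<lambda>f x. - f x"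
  unfolding ae_eq_def by (auto elim: AE_mp)

lift_definition scaleR_ae_fun :: "real \<Rightarrow> 'a ae_fun \<Rightarrow> 'a ae_fun" is "\<lambda>c f x. c * f x"
  unfolding ae_eq_def by (auto elim: AE_mp)

instance
  by standard (transfer; simp add: ae_eq_def algebra_simps)+

end

text \<open>
  A type cannot depend on the domain \<open>\<Omega>\<close>. A class of functions on \<open>\<Omega>\<close> is represented by its
  extension by zero to the whole space, so that \<open>L\<^sup>2(\<Omega>)\<close> and \<open>H\<^sup>1(\<Omega>)\<close> are linear subspaces of
  the type of classes. Derivatives are only tested inside \<open>\<Omega>\<close>, so the jump of the extension
  across the boundary plays no role.
\<close>

definition L2_space :: "'a::euclidean_space set \<Rightarrow> 'a ae_fun set" where
  "L2_space \<Omega> = {f. set_integrable lebesgue \<Omega> (\<lambda>x. (rep_ae_fun f x)\<^sup>2) \<and>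
     (AE x in lebesgue. x \<notin> \<Omega> \<longrightarrow> rep_ae_fun f x = 0)}"

definition L2_inner :: "'a::euclidean_space set \<Rightarrow> 'a ae_fun \<Rightarrow> 'a ae_fun \<Rightarrow> real" where
  "L2_inner \<Omega> f g = (LINT x:\<Omega>|lebesgue. rep_ae_fun f x * rep_ae_fun g x)"

definition L2_norm :: "'a::euclidean_space set \<Rightarrow> 'a ae_fun \<Rightarrow> real" where
  "L2_norm \<Omega> f = sqrt (L2_inner \<Omega> f f)"

primrec C_k :: "nat \<Rightarrow> ('a::euclidean_space \<Rightarrow> real) \<Rightarrow> bool" where
  "C_k 0 f \<longleftrightarrow> continuous_on UNIV f"
| "C_k (Suc k) f \<longleftrightarrow> f differentiable_on UNIV \<and>
     (\<forall>i\<in>Basis. C_k k (\<lambda>x. frechet_derivative f (at x) i))"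

definition test_fun :: "'a::euclidean_space set \<Rightarrow> ('a \<Rightarrow> real) \<Rightarrow> bool" where
  "test_fun \<Omega> \<phi> \<longleftrightarrow> (\<forall>k. C_k k \<phi>) \<and> compact (closure {x. \<phi> x \<noteq> 0}) \<and>
     closure {x. \<phi> x \<noteq> 0} \<subseteq> \<Omega>"

definition has_weak_partial ::
    "'a::euclidean_space set \<Rightarrow> 'a \<Rightarrow> 'a ae_fun \<Rightarrow> 'a ae_fun \<Rightarrow> bool" where
  "has_weak_partial \<Omega> i u g \<longleftrightarrow> (\<forall>\<phi>. test_fun \<Omega> \<phi> \<longrightarrow>
     (LINT x:\<Omega>|lebesgue. rep_ae_fun u x * frechet_derivative \<phi> (at x) i) =
     - (LINT x:\<Omega>|lebesgue. rep_ae_fun g x * \<phi> x))"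

definition H1_space :: "'a::euclidean_space set \<Rightarrow> 'a ae_fun set" where
  "H1_space \<Omega> = {u \<in> L2_space \<Omega>. \<forall>i\<in>Basis. \<exists>g\<in>L2_space \<Omega>. has_weak_partial \<Omega> i u g}"

text \<open>
  For \<open>u\<close> in \<open>H\<^sup>1(\<Omega>)\<close> the weak partial derivative is unique as a class that vanishes
  outside \<open>\<Omega>\<close>.
\<close>

definition weak_partial :: "'a::euclidean_space set \<Rightarrow> 'a \<Rightarrow> 'a ae_fun \<Rightarrow> 'a ae_fun" where
  "weak_partial \<Omega> i u = (THE g. g \<in> L2_space \<Omega> \<and> has_weak_partial \<Omega> i u g)"

definition H1_norm :: "'a::euclidean_space set \<Rightarrow> 'a ae_fun \<Rightarrow> real" where
  "H1_norm \<Omega> u = sqrt ((L2_norm \<Omega> u)\<^sup>2 + (\<Sum>i\<in>Basis. (L2_norm \<Omega> (weak_partial \<Omega> i u))\<^sup>2))"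

text \<open>
  Elements of \<open>H\<^sup>1(\<Omega>)\<close> have no pointwise boundary values; vanishing on the boundary means
  membership in the closure of the test functions in the \<open>H\<^sup>1\<close> norm. On a Lipschitz domain
  these are the functions of zero trace, and for functions continuous up to the boundary (such
  as finite element functions) this is pointwise vanishing on the boundary.
\<close>

definition vanishes_on_boundary :: "'a::euclidean_space set \<Rightarrow> 'a ae_fun \<Rightarrow> bool" where
  "vanishes_on_boundary \<Omega> u \<longleftrightarrow> u \<in> H1_space \<Omega> \<and>
     (\<forall>\<epsilon>>0. \<exists>\<phi>. test_fun \<Omega> \<phi> \<and> H1_norm \<Omega> (u - abs_ae_fun \<phi>) < \<epsilon>)"

text \<open>
  Near each boundary point \<open>\<Omega>\<close> is the part above the graph of a Lipschitz function \<open>\<gamma>\<close> on the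
  hyperplane orthogonal to some unit vector \<open>n\<close>.
\<close>

definition lipschitz_boundary :: "'a::euclidean_space set \<Rightarrow> bool" where
  "lipschitz_boundary \<Omega> \<longleftrightarrow> (\<forall>x\<in>frontier \<Omega>. \<exists>r>0. \<exists>n. \<exists>\<gamma>. \<exists>L. norm n = 1 \<and>
     L-lipschitz_on {y. y \<bullet> n = 0} \<gamma> \<and>
     \<Omega> \<inter> ball x r = {y \<in> ball x r. y \<bullet> n > \<gamma> (y - (y \<bullet> n) *\<^sub>R n)})"

definition convex_polygonal_domain :: "'a::euclidean_space set \<Rightarrow> bool" where
  "convex_polygonal_domain \<Omega> \<longleftrightarrow> open \<Omega> \<and> \<Omega> \<noteq> {} \<and> convex \<Omega> \<and> bounded \<Omega> \<and>
     polytope (closure \<Omega>) \<and> lipschitz_boundary \<Omega>"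

definition bilinear_form_on :: "'v::real_vector set \<Rightarrow> ('v \<Rightarrow> 'v \<Rightarrow> real) \<Rightarrow> bool" where
  "bilinear_form_on S b \<longleftrightarrow>
     (\<forall>u\<in>S. \<forall>v\<in>S. \<forall>w\<in>S. b (u + v) w = b u w + b v w \<and> b w (u + v) = b w u + b w v) \<and>
     (\<forall>c. \<forall>u\<in>S. \<forall>v\<in>S. b (c *\<^sub>R u) v = c * b u v \<and> b u (c *\<^sub>R v) = c * b u v)"

definition symmetric_form_on :: "'v set \<Rightarrow> ('v \<Rightarrow> 'v \<Rightarrow> real) \<Rightarrow> bool" where
  "symmetric_form_on S b \<longleftrightarrow> (\<forall>u\<in>S. \<forall>v\<in>S. b u v = b v u)"

definition has_finite_dim :: "'v::real_vector set \<Rightarrow> nat \<Rightarrow> bool" where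
  "has_finite_dim V n \<longleftrightarrow> (\<exists>B. finite B \<and> independent B \<and> span B = V \<and> card B = n)"

definition optimality_system ::
    "'a::euclidean_space set \<Rightarrow> 'a ae_fun set \<Rightarrow> 'a ae_fun set \<Rightarrow>
     ('a ae_fun \<Rightarrow> 'a ae_fun \<Rightarrow> real) \<Rightarrow> real \<Rightarrow> 'a ae_fun \<Rightarrow>
     'a ae_fun \<Rightarrow> 'a ae_fun \<Rightarrow> 'a ae_fun \<Rightarrow> bool" where
  "optimality_system \<Omega> V0 M b \<beta> uhat u f l \<longleftrightarrow> u \<in> V0 \<and> f \<in> M \<and> l \<in> V0 \<and>
     (\<forall>v\<in>V0. b u v = L2_inner \<Omega> f v) \<and>
     (\<forall>v\<in>V0. b l v = - L2_inner \<Omega> (u - uhat) v) \<and>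
     (\<forall>g\<in>M. 2 * \<beta> * L2_inner \<Omega> f g = L2_inner \<Omega> g l)"

definition coercivity_constant ::
    "'a::euclidean_space set \<Rightarrow> ('a ae_fun \<Rightarrow> 'a ae_fun \<Rightarrow> real) \<Rightarrow> 'a ae_fun set \<Rightarrow> ereal" where
  "coercivity_constant \<Omega> b V = (INF v\<in>V - {0}. ereal (b v v / (H1_norm \<Omega> v)\<^sup>2))"

definition B_form ::
    "'a::euclidean_space set \<Rightarrow> ('a ae_fun \<Rightarrow> 'a ae_fun \<Rightarrow> real) \<Rightarrow>
     'a ae_fun \<times> 'a ae_fun \<Rightarrow> 'a ae_fun \<Rightarrow> real" where
  "B_form \<Omega> b w q = b (fst w) q - L2_inner \<Omega> (snd w) q"

definition U_norm :: "'a::euclidean_space set \<Rightarrow> 'a ae_fun \<times> 'a ae_fun \<Rightarrow> real" where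
  "U_norm \<Omega> w = H1_norm \<Omega> (fst w) + L2_norm \<Omega> (snd w)"

definition inf_sup_value ::
    "'a::euclidean_space set \<Rightarrow> ('a ae_fun \<Rightarrow> 'a ae_fun \<Rightarrow> real) \<Rightarrow>
     ('a ae_fun \<times> 'a ae_fun) set \<Rightarrow> 'a ae_fun set \<Rightarrow> ereal" where
  "inf_sup_value \<Omega> b U Z =
     (INF z\<in>Z - {0}. SUP w\<in>U - {0}. ereal (B_form \<Omega> b w z / (U_norm \<Omega> w * H1_norm \<Omega> z)))"

definition satisfies_inf_sup ::
    "'a::euclidean_space set \<Rightarrow> ('a ae_fun \<Rightarrow> 'a ae_fun \<Rightarrow> real) \<Rightarrow>
     ('a ae_fun \<times> 'a ae_fun) set \<Rightarrow> 'a ae_fun set \<Rightarrow> bool" where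
  "satisfies_inf_sup \<Omega> b U Z \<longleftrightarrow> inf_sup_value \<Omega> b U Z > 0"

end

theory Submission
  imports Defs
begin

text \<open>
  Because the trial space \<open>X\<close> and the test space \<open>Z\<close> are the same space \<open>Q\<close>, every nonzero
  test function \<open>z\<close> gives a trial pair \<open>(z, 0)\<close>. On this pair the control term of the mixed
  form drops out and the inf-sup quotient is the Rayleigh quotient
  \<open>a(z,z;\<mu>) / \<parallel>z\<parallel>\<^sup>2\<close> of the energy form in the \<open>H\<^sup>1\<close> norm. The supremum over trial pairs
  therefore dominates this quotient, and the infimum over \<open>z\<close> gives
  \<open>\<beta>\<^sup>N(\<mu>)\<close> at least the coercivity constant on \<open>Q\<close>
  (lemma \<open>inf_sup_value_ge_coercivity_constant\<close>). All snapshots of the state and the adjoint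
  lie in \<open>V\<^sub>0\<^sup>h\<close>, hence \<open>Q\<close> is contained in \<open>V\<^sup>h\<close>, and an infimum over a smaller set is
  larger.

  For the inf-sup condition it remains to see that the coercivity constant is positive. It is
  bounded below by \<open>\<alpha>\<^sub>0\<close>, once it is known that \<open>\<parallel>z\<parallel> > 0\<close> for \<open>z \<noteq> 0\<close>: otherwise the
  quotient would be \<open>0/0\<close>, which is \<open>0\<close> by convention. Definiteness of the norm is where the
  representation by classes extended by zero enters (lemma \<open>L2_norm_pos\<close>).
\<close>

text \<open>
  The representative that is chosen for the zero class need only vanish almost everywhere.
\<close>

lemma rep_zero_AE: "AE x in lebesgue. rep_ae_fun (0 :: 'a::euclidean_space ae_fun) x = 0"
proof -
  have "ae_eq (rep_ae_fun (abs_ae_fun (\<lambda>_ :: 'a. 0))) (\<lambda>_. 0)"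
    by (rule Quotient3_rep_abs[OF Quotient3_ae_fun]) (simp add: ae_eq_def)
  then show ?thesis
    by (simp add: zero_ae_fun_def ae_eq_def)
qed

lemma rep_borel_measurable: "rep_ae_fun u \<in> borel_measurable lebesgue"
  using Quotient3_rel_rep[OF Quotient3_ae_fun, of u u] by (simp add: ae_eq_def)

lemma ae_fun_eq_zeroI:
  assumes "AE x in lebesgue. rep_ae_fun u x = 0"
  shows "u = 0"
proof -
  have "AE x in lebesgue. rep_ae_fun u x = rep_ae_fun 0 x"
    using assms rep_zero_AE by eventually_elim simp
  then have "ae_eq (rep_ae_fun u) (rep_ae_fun 0)"
    by (simp add: ae_eq_def rep_borel_measurable)
  then show ?thesis
    by (simp add: Quotient3_rel_rep[OF Quotient3_ae_fun])
qed

lemma L2_inner_zero_left: "L2_inner \<Omega> 0 v = 0"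
proof -
  have "AE x in lebesgue. indicat_real \<Omega> x *\<^sub>R (rep_ae_fun 0 x * rep_ae_fun v x) = 0"
    using rep_zero_AE by eventually_elim simp
  then show ?thesis
    unfolding L2_inner_def set_lebesgue_integral_def by (rule integral_eq_zero_AE)
qed

lemma L2_norm_zero: "L2_norm \<Omega> 0 = 0"
  by (simp add: L2_norm_def L2_inner_zero_left)

text \<open>
  A vanishing integral of the square forces \<open>u = 0\<close> almost everywhere inside \<open>\<Omega>\<close>; outside
  \<open>\<Omega>\<close> this is part of membership in the space, so the whole class is zero.
\<close>

lemma L2_norm_pos:
  assumes "u \<in> L2_space \<Omega>" and "u \<noteq> 0"
  shows "L2_norm \<Omega> u > 0"
proof -
  define g where "g x = indicat_real \<Omega> x *\<^sub>R (rep_ae_fun u x)\<^sup>2" for x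
  have inner: "L2_inner \<Omega> u u = integral\<^sup>L lebesgue g"
    by (simp add: L2_inner_def set_lebesgue_integral_def g_def[abs_def] power2_eq_square)
  have int: "integrable lebesgue g"
    and outside: "AE x in lebesgue. x \<notin> \<Omega> \<longrightarrow> rep_ae_fun u x = 0"
    using assms(1) by (simp_all add: L2_space_def set_integrable_def g_def[abs_def])
  have nonneg: "AE x in lebesgue. 0 \<le> g x"
    by (simp add: g_def)
  have "integral\<^sup>L lebesgue g \<noteq> 0"
  proof
    assume "integral\<^sup>L lebesgue g = 0"
    then have "AE x in lebesgue. g x = 0"
      using integral_nonneg_eq_0_iff_AE[OF int nonneg] by simp
    with outside have "AE x in lebesgue. rep_ae_fun u x = 0"
      by eventually_elim (auto simp: g_def indicator_def split: if_splits)
    with assms(2) show False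
      using ae_fun_eq_zeroI by blast
  qed
  moreover have "integral\<^sup>L lebesgue g \<ge> 0"
    using nonneg by (rule integral_nonneg_AE)
  ultimately show ?thesis
    by (simp add: L2_norm_def inner)
qed

lemma H1_norm_pos:
  assumes "u \<in> H1_space \<Omega>" and "u \<noteq> 0"
  shows "H1_norm \<Omega> u > 0"
proof -
  have "L2_norm \<Omega> u > 0"
    using assms by (intro L2_norm_pos) (auto simp: H1_space_def)
  then show ?thesis
    unfolding H1_norm_def by (simp add: add_pos_nonneg sum_nonneg)
qed

lemma coercivity_constant_antimono:
  "W \<subseteq> V \<Longrightarrow> coercivity_constant \<Omega> b V \<le> coercivity_constant \<Omega> b W"
  unfolding coercivity_constant_def by (rule INF_superset_mono) auto

lemma coercivity_constant_ge:
  assumes "V \<subseteq> H1_space \<Omega>"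
    and "\<And>v. v \<in> V \<Longrightarrow> b v v \<ge> \<alpha> * (H1_norm \<Omega> v)\<^sup>2"
  shows "coercivity_constant \<Omega> b V \<ge> ereal \<alpha>"
  unfolding coercivity_constant_def
proof (rule INF_greatest)
  fix v assume "v \<in> V - {0}"
  with assms H1_norm_pos[of v \<Omega>] show "ereal \<alpha> \<le> ereal (b v v / (H1_norm \<Omega> v)\<^sup>2)"
    by (auto simp: pos_le_divide_eq)
qed

text \<open>
  For a test function \<open>z\<close> the trial pair \<open>(z, 0)\<close> is admissible and turns the inf-sup
  quotient into the Rayleigh quotient of \<open>b\<close> at \<open>z\<close>.
\<close>

lemma inf_sup_value_ge_coercivity_constant:
  assumes "0 \<in> Y"
  shows "coercivity_constant \<Omega> b Z \<le> inf_sup_value \<Omega> b (Z \<times> Y) Z"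
  unfolding coercivity_constant_def inf_sup_value_def
proof (rule INF_mono, intro bexI)
  fix z assume z: "z \<in> Z - {0}"
  have "b z z / (H1_norm \<Omega> z)\<^sup>2 =
      B_form \<Omega> b (z, 0) z / (U_norm \<Omega> (z, 0) * H1_norm \<Omega> z)"
    by (simp add: B_form_def U_norm_def L2_inner_zero_left L2_norm_zero power2_eq_square)
  moreover have "(z, 0) \<in> Z \<times> Y - {0}"
    using z assms by (auto simp: zero_prod_def)
  ultimately show "ereal (b z z / (H1_norm \<Omega> z)\<^sup>2) \<le>
      (SUP w\<in>Z \<times> Y - {0}. ereal (B_form \<Omega> b w z / (U_norm \<Omega> w * H1_norm \<Omega> z)))"
    by (metis (no_types, lifting) SUP_upper)
qed

lemma has_finite_dim_subspace: "has_finite_dim V n \<Longrightarrow> subspace V"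
  unfolding has_finite_dim_def by (auto intro: subspace_span)

theorem lemma4p1:
  fixes \<Omega> :: "(real ^ 'd) set"
    and \<Gamma> :: "(real ^ 'm) set"
    and a :: "(real ^ 'd) ae_fun \<Rightarrow> (real ^ 'd) ae_fun \<Rightarrow> real ^ 'm \<Rightarrow> real"
    and aq :: "nat \<Rightarrow> (real ^ 'd) ae_fun \<Rightarrow> (real ^ 'd) ae_fun \<Rightarrow> real"
    and \<Theta> :: "nat \<Rightarrow> real ^ 'm \<Rightarrow> real"
    and Qa dimV dimM N :: nat
    and \<alpha>\<^sub>0 \<alpha>\<^sub>1 \<beta> :: real
    and Vh Vh0 Mh Q X Y Z :: "(real ^ 'd) ae_fun set"
    and U :: "((real ^ 'd) ae_fun \<times> (real ^ 'd) ae_fun) set"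
    and uhat uh fh lh :: "real ^ 'm \<Rightarrow> (real ^ 'd) ae_fun"
    and \<mu>s :: "nat \<Rightarrow> real ^ 'm"
    and \<mu> :: "real ^ 'm"
  assumes "convex_polygonal_domain \<Omega>"
    and "\<And>\<nu>. \<nu> \<in> \<Gamma> \<Longrightarrow> bilinear_form_on (H1_space \<Omega>) (\<lambda>u v. a u v \<nu>)"
    and "\<alpha>\<^sub>0 > 0" and "\<alpha>\<^sub>1 > 0"
    and "\<And>\<nu> v. \<nu> \<in> \<Gamma> \<Longrightarrow> v \<in> H1_space \<Omega> \<Longrightarrow> a v v \<nu> \<ge> \<alpha>\<^sub>0 * (H1_norm \<Omega> v)\<^sup>2"
    and "\<And>\<nu> u v. \<nu> \<in> \<Gamma> \<Longrightarrow> u \<in> H1_space \<Omega> \<Longrightarrow> v \<in> H1_space \<Omega> \<Longrightarrow>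
           a u v \<nu> \<le> \<alpha>\<^sub>1 * H1_norm \<Omega> u * H1_norm \<Omega> v"
    and "\<And>q. q \<in> {1..Qa} \<Longrightarrow> bilinear_form_on (H1_space \<Omega>) (aq q)"
    and "\<And>q. q \<in> {1..Qa} \<Longrightarrow> symmetric_form_on (H1_space \<Omega>) (aq q)"
    and "\<And>\<nu> u v. \<nu> \<in> \<Gamma> \<Longrightarrow> u \<in> H1_space \<Omega> \<Longrightarrow> v \<in> H1_space \<Omega> \<Longrightarrow>
           a u v \<nu> = (\<Sum>q = 1..Qa. \<Theta> q \<nu> * aq q u v)"
    and "Vh \<subseteq> H1_space \<Omega>" and "has_finite_dim Vh dimV"
    and "Vh0 = {v \<in> Vh. vanishes_on_boundary \<Omega> v}"
    and "Mh \<subseteq> L2_space \<Omega>" and "has_finite_dim Mh dimM"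
    and "\<beta> > 0"
    and "\<And>\<nu>. \<nu> \<in> \<Gamma> \<Longrightarrow> uhat \<nu> \<in> L2_space \<Omega>"
    and "\<And>\<nu>. \<nu> \<in> \<Gamma> \<Longrightarrow>
           optimality_system \<Omega> Vh0 Mh (\<lambda>u v. a u v \<nu>) \<beta> (uhat \<nu>) (uh \<nu>) (fh \<nu>) (lh \<nu>)"
    and "N \<ge> 1"
    and "\<And>n. n \<in> {1..N} \<Longrightarrow> \<mu>s n \<in> \<Gamma>"
    and "\<mu> \<in> \<Gamma>"
    and "Q = span ((\<lambda>n. uh (\<mu>s n)) ` {1..N} \<union> (\<lambda>n. lh (\<mu>s n)) ` {1..N})"
    and "X = Q" and "Z = Q"
    and "Y = span ((\<lambda>n. fh (\<mu>s n)) ` {1..N})"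
    and "U = X \<times> Y"
  shows "satisfies_inf_sup \<Omega> (\<lambda>u v. a u v \<mu>) U Z \<and>
    inf_sup_value \<Omega> (\<lambda>u v. a u v \<mu>) U Z \<ge> coercivity_constant \<Omega> (\<lambda>u v. a u v \<mu>) Vh"
proof -
  note coercive = assms(5) and Vh_H1 = assms(10) and Vh_dim = assms(11) and Vh0 = assms(12)
    and snapshots = assms(17) and samples = assms(19) and \<mu> = assms(20)
    and Q = assms(21) and X = assms(22) and Z = assms(23) and Y = assms(24) and U = assms(25)
  let ?b = "\<lambda>u v. a u v \<mu>"
  have "uh \<nu> \<in> Vh \<and> lh \<nu> \<in> Vh" if "\<nu> \<in> \<Gamma>" for \<nu>
    using snapshots[OF that] by (simp add: optimality_system_def Vh0)
  then have "Q \<subseteq> Vh"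
    unfolding Q using samples has_finite_dim_subspace[OF Vh_dim]
    by (intro span_minimal) auto
  then have "coercivity_constant \<Omega> ?b Vh \<le> coercivity_constant \<Omega> ?b Z"
    unfolding Z by (rule coercivity_constant_antimono)
  also have "\<dots> \<le> inf_sup_value \<Omega> ?b U Z"
    unfolding U X Z Y by (intro inf_sup_value_ge_coercivity_constant span_zero)
  finally have ge: "coercivity_constant \<Omega> ?b Vh \<le> inf_sup_value \<Omega> ?b U Z" .
  have "ereal 0 < ereal \<alpha>\<^sub>0"
    using \<open>\<alpha>\<^sub>0 > 0\<close> by simp
  also have "ereal \<alpha>\<^sub>0 \<le> coercivity_constant \<Omega> ?b Vh"
    using coercive[OF \<mu>] Vh_H1 by (intro coercivity_constant_ge) auto
  also note ge
  finally show ?thesis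
    using ge by (simp add: satisfies_inf_sup_def zero_ereal_def)
qed

end
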